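(* Let $n,k$ be integers with $n\geq 4k+6$, and let $G$ be a graph with an even number $n$ of vertices. Then $\mathrm{mp}(G)=n-k$ if and only if $\delta(G)=n-k$.
   Context: All graphs are finite, simple and undirected; $\delta(G)$ is the minimum degree. A perfect matching is a set of edges covering every vertex exactly once; an almost-perfect matching is a set of edges covering every vertex except one exactly once and missing the remaining vertex. The matching preclusion number $\mathrm{mp}(G)$ is the minimum number of edges whose deletion leaves a graph with neither a perfect matching nor an almost-perfect matching ($\mathrm{mp}(G)=0$ if $G$ has neither). *)

theory Defs
  imports Main
begin

(* A graph is given by its vertex set V and its edge set E, an edge being the two-element set of
   its endpoints.  As usual for a setting with minimum degrees, graphs have at least one vertex. *)
definition simple_graph :: "'a set \<Rightarrow> 'a set set \<Rightarrow> bool" where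
  "simple_graph V E \<longleftrightarrow> finite V \<and> V \<noteq> {} \<and> (\<forall>e\<in>E. e \<subseteq> V \<and> card e = 2)"

definition degree :: "'a set set \<Rightarrow> 'a \<Rightarrow> nat" where
  "degree E v = card {e \<in> E. v \<in> e}"

definition min_degree :: "'a set \<Rightarrow> 'a set set \<Rightarrow> nat" where
  "min_degree V E = Min (degree E ` V)"

definition perfect_matching :: "'a set \<Rightarrow> 'a set set \<Rightarrow> 'a set set \<Rightarrow> bool" where
  "perfect_matching V E M \<longleftrightarrow> M \<subseteq> E \<and> (\<forall>v\<in>V. \<exists>!e. e \<in> M \<and> v \<in> e)"

definition almost_perfect_matching :: "'a set \<Rightarrow> 'a set set \<Rightarrow> 'a set set \<Rightarrow> bool" where
  "almost_perfect_matching V E M \<longleftrightarrow> M \<subseteq> E \<and>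
     (\<exists>u\<in>V. (\<forall>v\<in>V - {u}. \<exists>!e. e \<in> M \<and> v \<in> e) \<and> (\<forall>e\<in>M. u \<notin> e))"

definition matching_precluding :: "'a set \<Rightarrow> 'a set set \<Rightarrow> 'a set set \<Rightarrow> bool" where
  "matching_precluding V E F \<longleftrightarrow> F \<subseteq> E \<and>
     \<not> (\<exists>M. perfect_matching V (E - F) M) \<and> \<not> (\<exists>M. almost_perfect_matching V (E - F) M)"

(* If the graph has neither kind of matching, F = {} is allowed and the value is 0.  For at least
   two vertices the minimum is over a nonempty set, since F = E is precluding; only the one-vertex
   graph, whose empty edge set is an almost-perfect matching, has no precluding set. *)
definition mp :: "'a set \<Rightarrow> 'a set set \<Rightarrow> nat" where
  "mp V E = Min (card ` {F. matching_precluding V E F})"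

end

theory Submission
  imports Defs
begin

text \<open>Deleting all edges at a vertex of minimum degree leaves no perfect matching, and an even order
excludes almost-perfect matchings, so \<open>mp \<le> \<delta>\<close>. Conversely, let \<open>H = G - F\<close> have no perfect
matching. An edge-maximal supergraph of \<open>H\<close> without perfect matching has degree sum at most
\<open>n - 2\<close> on every nonadjacent pair, and Chvatal's choice of a nonadjacent pair with largest degree sum
yields some \<open>i \<le> n/2 - 1\<close> and \<open>i + 1\<close> vertices of degree at most \<open>i\<close> in \<open>H\<close>. Hence
\<open>card F \<ge> (i + 1) (\<delta> - i) - i (i + 1) / 2\<close>, which is at least \<open>\<delta>\<close> as soon as \<open>4 \<delta> \<ge> 3 n\<close>.\<close>

section \<open>Perfect matchings as fixed-point-free involutions along edges\<close>

definition mate_function :: "'a set \<Rightarrow> 'a set set \<Rightarrow> ('a \<Rightarrow> 'a) \<Rightarrow> bool" where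
  "mate_function V E m \<longleftrightarrow> (\<forall>x\<in>V. m x \<in> V \<and> m x \<noteq> x \<and> m (m x) = x \<and> {x, m x} \<in> E)"

lemma mate_function_imp_perfect_matching:
  assumes "mate_function V E m"
  shows "perfect_matching V E ((\<lambda>x. {x, m x}) ` V)"
  unfolding perfect_matching_def
proof (intro conjI ballI)
  show "(\<lambda>x. {x, m x}) ` V \<subseteq> E"
    using assms by (auto simp: mate_function_def)
  fix v assume v: "v \<in> V"
  show "\<exists>!e. e \<in> (\<lambda>x. {x, m x}) ` V \<and> v \<in> e"
  proof (rule ex1I[of _ "{v, m v}"])
    show "{v, m v} \<in> (\<lambda>x. {x, m x}) ` V \<and> v \<in> {v, m v}" using v by auto
    fix e assume "e \<in> (\<lambda>x. {x, m x}) ` V \<and> v \<in> e"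
    then obtain x where x: "x \<in> V" "e = {x, m x}" "v = x \<or> v = m x" by auto
    then have "m (m x) = x" using assms by (auto simp: mate_function_def)
    then show "e = {v, m v}" using x by auto
  qed
qed

lemma perfect_matching_imp_mate_function:
  assumes "\<forall>e\<in>E. e \<subseteq> V \<and> card e = 2" and pm: "perfect_matching V E M"
  obtains m where "mate_function V E m" "\<And>x. x \<in> V \<Longrightarrow> {x, m x} \<in> M"
proof -
  have "\<exists>y. y \<noteq> x \<and> y \<in> V \<and> {x, y} \<in> M" if x: "x \<in> V" for x
  proof -
    obtain e where e: "e \<in> M" "x \<in> e" using pm x by (auto simp: perfect_matching_def)
    then have "e \<in> E" using pm by (auto simp: perfect_matching_def)
    then have c: "card e = 2" "e \<subseteq> V" using assms by auto
    then obtain a b where "e = {a, b}" "a \<noteq> b" by (auto simp: card_2_iff)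
    then show ?thesis using e c(2) by (cases "x = a") (auto simp: insert_commute)
  qed
  then obtain m where m: "\<And>x. x \<in> V \<Longrightarrow> m x \<noteq> x \<and> m x \<in> V \<and> {x, m x} \<in> M" by metis
  have "m (m x) = x" if x: "x \<in> V" for x
  proof -
    have "m x \<in> V" using m x by blast
    then have "\<exists>!e. e \<in> M \<and> m x \<in> e" using pm by (auto simp: perfect_matching_def)
    then have "{x, m x} = {m x, m (m x)}" using m x by blast
    then show ?thesis using m x by (auto simp: doubleton_eq_iff)
  qed
  then have "mate_function V E m"
    using m pm by (auto simp: mate_function_def perfect_matching_def)
  then show ?thesis using that m by blast
qed

lemma finite_edges:
  assumes "finite V" "\<forall>e\<in>E. e \<subseteq> V \<and> card e = 2"
  shows "finite E"
  using assms by (intro finite_subset[of E "Pow V"]) auto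

text \<open>Guarantees that an edge-maximal graph without perfect matching on an even vertex set is
  not complete, so that it has a nonadjacent pair. The induction matches two vertices with each
  other and removes them.\<close>

lemma complete_graph_mate_function:
  assumes "finite V" "even (card V)"
  shows "\<exists>m. mate_function V {e. e \<subseteq> V \<and> card e = 2} m"
  using assms
proof (induction "card V" arbitrary: V rule: less_induct)
  case less
  show ?case
  proof (cases "V = {}")
    case True
    then show ?thesis by (auto simp: mate_function_def)
  next
    case False
    then obtain a where a: "a \<in> V" by blast
    have "V \<noteq> {a}" using less.prems by auto
    then obtain b where b: "b \<in> V" "b \<noteq> a" using a by blast
    let ?W = "V - {a, b}"
    have cW: "card ?W = card V - 2" using a b less.prems by (simp add: card_Diff_subset)
    have "card V > 0" using False less.prems by (simp add: card_gt_0_iff)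
    then obtain m where m: "mate_function ?W {e. e \<subseteq> ?W \<and> card e = 2} m"
      using less.hyps[of ?W] less.prems cW by auto
    have "mate_function V {e. e \<subseteq> V \<and> card e = 2} (m(a := b, b := a))"
      using m a b by (auto simp: mate_function_def)
    then show ?thesis by blast
  qed
qed

section \<open>Degree bounds in graphs without a perfect matching\<close>

lemma degree_eq_card_neighbours:
  assumes "\<forall>e\<in>E. e \<subseteq> V \<and> card e = 2"
  shows "degree E v = card {x \<in> V. {v, x} \<in> E}"
proof -
  have "bij_betw (\<lambda>x. {v, x}) {x \<in> V. {v, x} \<in> E} {e \<in> E. v \<in> e}"
    unfolding bij_betw_def
  proof
    show "inj_on (\<lambda>x. {v, x}) {x \<in> V. {v, x} \<in> E}"
      by (auto simp: inj_on_def doubleton_eq_iff)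
    have "e \<in> (\<lambda>x. {v, x}) ` {x \<in> V. {v, x} \<in> E}" if e: "e \<in> E" "v \<in> e" for e
    proof -
      obtain a b where "e = {a, b}" using assms e by (meson card_2_iff)
      then obtain x where x: "e = {v, x}" using e by (auto simp: insert_commute)
      then have "x \<in> V" using e(1) assms by auto
      then show ?thesis using e(1) unfolding x by (intro image_eqI[of _ _ x]) auto
    qed
    then show "(\<lambda>x. {v, x}) ` {x \<in> V. {v, x} \<in> E} = {e \<in> E. v \<in> e}" by auto
  qed
  then show ?thesis unfolding degree_def by (simp add: bij_betw_same_card)
qed

text \<open>An exchange argument: the matching must use the new edge \<open>{u, w}\<close>. If
  \<open>u\<close> were adjacent to some \<open>x\<close> and \<open>w\<close> to the mate of
  \<open>x\<close>, re-pairing these four vertices would give a perfect matching of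
  \<open>E\<close>. So the mates of the neighbours of \<open>u\<close> are not neighbours of
  \<open>w\<close>, and both sets lie in \<open>V - {u, w}\<close>.\<close>

lemma degree_sum_nonadjacent:
  assumes fin: "finite V" and E: "\<forall>e\<in>E. e \<subseteq> V \<and> card e = 2"
    and nopm: "\<not> (\<exists>M. perfect_matching V E M)"
    and pm: "perfect_matching V (insert {u, w} E) M"
    and uw: "u \<in> V" "w \<in> V" "u \<noteq> w" "{u, w} \<notin> E"
  shows "degree E u + degree E w + 2 \<le> card V"
proof -
  have "\<forall>e\<in>insert {u, w} E. e \<subseteq> V \<and> card e = 2" using E uw by auto
  from perfect_matching_imp_mate_function[OF this pm]
  obtain m where m: "mate_function V (insert {u, w} E) m" "\<And>x. x \<in> V \<Longrightarrow> {x, m x} \<in> M"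
    by blast
  have nomate: "\<not> mate_function V E m'" for m'
    using mate_function_imp_perfect_matching nopm by blast
  have mu: "m u = w"
  proof (rule ccontr)
    assume "m u \<noteq> w"
    then have "{x, m x} \<noteq> {u, w}" if "x \<in> V" for x
      using m(1) that by (auto simp: doubleton_eq_iff mate_function_def)
    then have "mate_function V E m" using m(1) by (simp add: mate_function_def)
    then show False using nomate by blast
  qed
  then have mw: "m w = u" using m(1) uw by (auto simp: mate_function_def)
  have minv: "m (m x) = x" "m x \<in> V" "m x \<noteq> x" if "x \<in> V" for x
    using m(1) that by (auto simp: mate_function_def)
  have mE: "{x, m x} \<in> E" if "x \<in> V" "x \<noteq> u" "x \<noteq> w" for x
    using m(1) that by (auto simp: mate_function_def doubleton_eq_iff)
  have no_loop: "{x, x} \<notin> E" for x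
    using E by fastforce
  let ?A = "{x \<in> V. {u, x} \<in> E}" and ?B = "{x \<in> V. {w, x} \<in> E}"
  have A: "u \<notin> ?A" "w \<notin> ?A" and B: "u \<notin> ?B" "w \<notin> ?B"
    using no_loop uw(4) by (auto simp: insert_commute)
  have disj: "m ` ?A \<inter> ?B = {}"
  proof (rule ccontr)
    assume "m ` ?A \<inter> ?B \<noteq> {}"
    then obtain x where x: "x \<in> V" "{u, x} \<in> E" "{w, m x} \<in> E" by blast
    have xn: "x \<noteq> u" "x \<noteq> w" using A x by auto
    have mn: "m x \<noteq> u" "m x \<noteq> w" "m x \<noteq> x"
      using B x minv by auto
    \<comment> \<open>The four vertices are closed under \<open>m\<close>, hence so is their
      complement, where the old matching is kept.\<close>
    have oth: "m z \<notin> {u, w, x, m x}" if "z \<in> V" "z \<notin> {u, w, x, m x}" for z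
      using minv that mu mw x(1) by (metis insertCI insertE singletonD)
    \<comment> \<open>Replaces the matching edges \<open>{u, w}\<close> and \<open>{x, m x}\<close>
      by \<open>{u, x}\<close> and \<open>{w, m x}\<close>, both in \<open>E\<close>.\<close>
    let ?m = "m(u := x, x := u, w := m x, m x := w)"
    have "mate_function V E ?m"
      unfolding mate_function_def
    proof
      fix z assume z: "z \<in> V"
      show "?m z \<in> V \<and> ?m z \<noteq> z \<and> ?m (?m z) = z \<and> {z, ?m z} \<in> E"
      proof (cases "z \<in> {u, w, x, m x}")
        case True
        then show ?thesis using xn mn mn[symmetric] x uw(1-3) minv by (auto simp: insert_commute)
      next
        case False
        then show ?thesis using oth[OF z False] minv[OF z] mE[OF z] z by auto
      qed
    qed
    then show False using nomate by blast
  qed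
  have "inj_on m V" using minv by (metis inj_onI)
  then have "card (m ` ?A) = card ?A" by (intro card_image) (auto simp: inj_on_def)
  moreover have "m ` ?A \<union> ?B \<subseteq> V - {u, w}"
  proof -
    have "m x \<noteq> u \<and> m x \<noteq> w" if "x \<in> ?A" for x
      using that A minv mu mw by (metis mem_Collect_eq)
    then show ?thesis using B minv by auto
  qed
  then have "card (m ` ?A \<union> ?B) \<le> card V - 2"
    using card_mono[of "V - {u, w}" "m ` ?A \<union> ?B"] fin uw(1-3)
    by (simp add: card_Diff_subset)
  moreover have "card (m ` ?A \<union> ?B) = card (m ` ?A) + card ?B"
    using disj fin by (intro card_Un_disjoint) auto
  \<comment> \<open>Ensures that the natural subtraction \<open>card V - 2\<close> is not
    truncated.\<close>
  moreover have "card V \<ge> 2"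
    using card_mono[of V "{u, w}"] fin uw by simp
  ultimately show ?thesis
    using degree_eq_card_neighbours[OF E] by simp
qed

lemma degree_mono:
  assumes "finite E" "H \<subseteq> E"
  shows "degree H v \<le> degree E v"
  unfolding degree_def using assms by (intro card_mono) auto

text \<open>In the maximal supergraph \<open>E\<close>, choose a nonadjacent pair \<open>u\<close>,
  \<open>w\<close> of largest degree sum. Any other non-neighbour \<open>x\<close> of
  \<open>w\<close> competes with \<open>u\<close>, so its degree is at most that of
  \<open>u\<close>; passing from \<open>E\<close> down to \<open>H\<close> only lowers degrees. The
  role of \<open>i\<close> is played by \<open>degree E u\<close>.\<close>

lemma many_low_degree_vertices:
  assumes fin: "finite V" and H: "\<forall>e\<in>H. e \<subseteq> V \<and> card e = 2"
    and ev: "even (card V)" and nopm: "\<not> (\<exists>M. perfect_matching V H M)"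
  obtains i W where "2 * i + 2 \<le> card V" "W \<subseteq> V" "card W = i + 1" "\<forall>w\<in>W. degree H w \<le> i"
proof -
  let ?K = "{e. e \<subseteq> V \<and> card e = 2}"
  let ?S = "{E. H \<subseteq> E \<and> E \<subseteq> ?K \<and> \<not> (\<exists>M. perfect_matching V E M)}"
  have finK: "finite ?K" using fin by (rule finite_edges) auto
  then have "finite ?S" by (intro finite_subset[of ?S "Pow ?K"]) auto
  moreover have "H \<in> ?S" using H nopm by auto
  ultimately obtain E where ES: "E \<in> ?S" and maxE: "\<And>E'. E' \<in> ?S \<Longrightarrow> E \<subseteq> E' \<Longrightarrow> E = E'"
    using finite_has_maximal[of ?S] by (metis (no_types, lifting) empty_iff)
  have HE: "H \<subseteq> E" and EK: "\<forall>e\<in>E. e \<subseteq> V \<and> card e = 2"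
    and Enopm: "\<not> (\<exists>M. perfect_matching V E M)"
    using ES by auto
  have finE: "finite E" using fin EK by (rule finite_edges)
  have sum: "degree E x + degree E y + 2 \<le> card V"
    if xy: "x \<in> V" "y \<in> V" "x \<noteq> y" "{x, y} \<notin> E" for x y
  proof -
    have "insert {x, y} E \<notin> ?S" using maxE[of "insert {x, y} E"] xy by blast
    then have "\<exists>M. perfect_matching V (insert {x, y} E) M"
      using ES xy by auto
    then show ?thesis using degree_sum_nonadjacent fin EK Enopm xy by metis
  qed
  let ?P = "{(x, y). x \<in> V \<and> y \<in> V \<and> x \<noteq> y \<and> {x, y} \<notin> E}"
  have P_ne: "?P \<noteq> {}"
  proof
    assume "?P = {}"
    then have "?K \<subseteq> E" by (auto simp: card_2_iff)
    then have "E = ?K" using EK by blast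
    then show False
      using complete_graph_mate_function[OF fin ev] mate_function_imp_perfect_matching Enopm
      by blast
  qed
  have finP: "finite ?P" using fin by (auto intro: finite_subset[of _ "V \<times> V"])
  define f where "f p = degree E (fst p) + degree E (snd p)" for p
  have "Max (f ` ?P) \<in> f ` ?P" using finP P_ne by (intro Max_in) simp_all
  then obtain p where p: "p \<in> ?P" "f p = Max (f ` ?P)" by (metis (no_types, lifting) imageE)
  have pmax: "f q \<le> f p" if "q \<in> ?P" for q
    unfolding p(2) using finP that by (intro Max_ge finite_imageI imageI)
  \<comment> \<open>Orienting the pair so that \<open>u\<close> has the smaller degree makes
    \<open>2 * degree E u\<close> at most the degree sum, hence at most
    \<open>card V - 2\<close>.\<close>
  obtain u w where uw: "u \<in> V" "w \<in> V" "u \<noteq> w" "{u, w} \<notin> E" "degree E u \<le> degree E w"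
    and mx: "\<And>x y. x \<in> V \<Longrightarrow> y \<in> V \<Longrightarrow> x \<noteq> y \<Longrightarrow> {x, y} \<notin> E \<Longrightarrow>
      degree E x + degree E y \<le> degree E u + degree E w"
  proof (cases "degree E (fst p) \<le> degree E (snd p)")
    case True
    show ?thesis
      by (rule that[of "fst p" "snd p"]) (use p pmax True in \<open>auto simp: f_def\<close>)
  next
    case False
    show ?thesis
      by (rule that[of "snd p" "fst p"])
        (use p pmax False in \<open>auto simp: f_def insert_commute add.commute\<close>)
  qed
  let ?i = "degree E u"
  let ?N = "{x \<in> V. {w, x} \<in> E}" and ?W = "{x \<in> V. x \<noteq> w \<and> {w, x} \<notin> E}"
  have "{w, w} \<notin> E" using EK by fastforce
  then have split: "V - {w} = ?N \<union> ?W" by auto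
  have "card (V - {w}) = card ?N + card ?W"
    unfolding split using fin by (intro card_Un_disjoint) auto
  then have "card V = degree E w + card ?W + 1"
    using fin uw(2) degree_eq_card_neighbours[OF EK, of w] card.remove[OF fin uw(2)] by linarith
  \<comment> \<open>The \<open>card V - 1 - degree E w\<close> non-neighbours of \<open>w\<close>
    number at least \<open>?i + 1\<close> by the degree sum bound.\<close>
  then have "?i + 1 \<le> card ?W" using sum[OF uw(1-4)] by simp
  from obtain_subset_with_card_n[OF this] obtain W where W: "W \<subseteq> ?W" "card W = ?i + 1" .
  have "degree H x \<le> ?i" if "x \<in> W" for x
  proof -
    have "degree E x + degree E w \<le> degree E u + degree E w"
      using mx[of x w] W(1) that uw(2) by (auto simp: insert_commute)
    then show ?thesis using degree_mono[OF finE HE, of x] by simp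
  qed
  moreover have "W \<subseteq> V" using W(1) by blast
  moreover have "2 * ?i + 2 \<le> card V" using sum[OF uw(1-4)] uw(5) by linarith
  ultimately show ?thesis using that[of ?i W] W(2) by blast
qed

section \<open>Counting deleted edges, and parity\<close>

lemma sum_degree_le:
  assumes "finite F" "\<forall>e\<in>F. card e = 2" "finite W"
  shows "(\<Sum>w\<in>W. degree F w) \<le> card F + (card W choose 2)"
proof -
  have "(\<Sum>w\<in>W. degree F w) = (\<Sum>w\<in>W. \<Sum>e\<in>F. if w \<in> e then 1 else 0)"
    unfolding degree_def using assms by (simp add: sum.If_cases Int_def)
  also have "\<dots> = (\<Sum>e\<in>F. \<Sum>w\<in>W. if w \<in> e then 1 else 0)" by (rule sum.swap)
  also have "\<dots> = (\<Sum>e\<in>F. card (W \<inter> e))" using assms by (simp add: sum.If_cases Int_def)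
  \<comment> \<open>An edge is counted twice only if both its ends lie in \<open>W\<close>; there
    are at most \<open>card W choose 2\<close> such edges.\<close>
  also have "\<dots> \<le> (\<Sum>e\<in>F. 1 + (if e \<subseteq> W then 1 else 0))"
  proof (rule sum_mono)
    fix e assume "e \<in> F"
    then have e: "card e = 2" "finite e" using assms(2) by (auto intro: card_ge_0_finite)
    show "card (W \<inter> e) \<le> 1 + (if e \<subseteq> W then 1 else 0)"
    proof (cases "e \<subseteq> W")
      case True
      then show ?thesis using e by (simp add: Int_absorb1)
    next
      case False
      then have "card (W \<inter> e) < card e" using e by (intro psubset_card_mono) auto
      then show ?thesis using e by simp
    qed
  qed
  also have "\<dots> = card F + card {e \<in> F. e \<subseteq> W}"
    unfolding sum.distrib using assms by (simp add: sum.If_cases Int_def)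
  also have "card {e \<in> F. e \<subseteq> W} \<le> card {e. e \<subseteq> W \<and> card e = 2}"
    using assms by (intro card_mono) (auto intro: finite_subset[of _ "Pow W"])
  finally show ?thesis using n_subsets[OF assms(3), of 2] by simp
qed

text \<open>The matching edges would partition the odd number of vertices other than
  \<open>u\<close> into pairs.\<close>

lemma no_almost_perfect_matching_even:
  assumes fin: "finite V" and E: "\<forall>e\<in>E. e \<subseteq> V \<and> card e = 2" and ev: "even (card V)"
  shows "\<not> almost_perfect_matching V E M"
proof
  assume "almost_perfect_matching V E M"
  then obtain u where u: "u \<in> V" "M \<subseteq> E" "\<forall>v\<in>V - {u}. \<exists>!e. e \<in> M \<and> v \<in> e" "\<forall>e\<in>M. u \<notin> e"
    by (auto simp: almost_perfect_matching_def)
  have sub: "e \<subseteq> V - {u}" "card e = 2" if "e \<in> M" for e using that u E by auto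
  have un: "\<Union>M = V - {u}" using sub u(3) by blast
  have "e \<inter> e' = {}" if "e \<in> M" "e' \<in> M" "e \<noteq> e'" for e e'
    using that u(3) sub(1) by (metis disjoint_iff subsetD)
  moreover have "finite M" using fin un by (metis finite_Diff finite_UnionD)
  ultimately have "2 * card M = card (V - {u})"
    using card_partition[of M 2] sub fin un by auto
  moreover have "card V = Suc (card (V - {u}))" using fin u(1) by (metis card.remove)
  ultimately show False using ev by (metis even_Suc dvd_triv_left)
qed

lemma card_matching_precluding_ge:
  assumes G: "simple_graph V E" and ev: "even (card V)"
    and deg: "3 * card V \<le> 4 * min_degree V E"
    and F: "matching_precluding V E F"
  shows "min_degree V E \<le> card F"
proof -
  have fin: "finite V" and E: "\<forall>e\<in>E. e \<subseteq> V \<and> card e = 2"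
    using G by (auto simp: simple_graph_def)
  have finE: "finite E" using fin E by (rule finite_edges)
  have FE: "F \<subseteq> E" and nopm: "\<not> (\<exists>M. perfect_matching V (E - F) M)"
    using F by (auto simp: matching_precluding_def)
  let ?d = "min_degree V E"
  have "\<forall>e\<in>E - F. e \<subseteq> V \<and> card e = 2" using E by blast
  from many_low_degree_vertices[OF fin this ev nopm]
  obtain i W where W: "2 * i + 2 \<le> card V" "W \<subseteq> V" "card W = i + 1"
    "\<forall>w\<in>W. degree (E - F) w \<le> i" by blast
  \<comment> \<open>Each low-degree vertex has lost at least \<open>?d - i\<close> edges to
    \<open>F\<close>; written additively to avoid truncated subtraction.\<close>
  have "?d \<le> i + degree F w" if w: "w \<in> W" for w
  proof -
    have "?d \<le> degree E w"
      unfolding min_degree_def using fin W w by (intro Min_le) auto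
    also have "degree E w = degree (E - F) w + degree F w"
    proof -
      have "{e \<in> E. w \<in> e} = {e \<in> E - F. w \<in> e} \<union> {e \<in> F. w \<in> e}" using FE by blast
      then show ?thesis unfolding degree_def
        using finE FE by (simp add: finite_subset card_Un_disjoint disjoint_iff)
    qed
    finally show ?thesis using W(4) w by fastforce
  qed
  then have "(\<Sum>w\<in>W. ?d) \<le> (\<Sum>w\<in>W. i + degree F w)" by (intro sum_mono) auto
  then have 1: "(i + 1) * ?d \<le> (i + 1) * i + (\<Sum>w\<in>W. degree F w)"
    using W(3) by (simp add: sum.distrib)
  have 2: "(\<Sum>w\<in>W. degree F w) \<le> card F + (card W choose 2)"
    using finE FE E W(2) fin by (intro sum_degree_le) (auto intro: finite_subset)
  have 3: "2 * ((i + 1) choose 2) = (i + 1) * i"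
    by (simp add: choose_two)
  \<comment> \<open>From \<open>2 * (i + 1) \<le> card V\<close> and the degree hypothesis: 6 (i +
    1) \<le> 3 \<open>card V\<close> \<le> 4 \<open>?d\<close>.\<close>
  have 4: "3 * (i + 1) \<le> 2 * ?d" using W(1) deg by presburger
  \<comment> \<open>Doubling \<open>1\<close> and inserting \<open>2\<close> and \<open>3\<close>
    gives 2 (i + 1) \<open>?d\<close> \<le> 3 i (i + 1) + 2 \<open>card F\<close>. Bounding 3 i (i +
    1) by 2 i \<open>?d\<close> and cancelling leaves \<open>?d \<le> card F\<close>.\<close>
  have "i * (3 * (i + 1)) \<le> i * (2 * ?d)" using 4 by (rule mult_le_mono2)
  then show ?thesis using 1 2 3 W(3) by (simp add: algebra_simps)
qed

section \<open>Stars as precluding sets, and the value of \<open>mp\<close>\<close>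

lemma matching_precluding_star:
  assumes G: "simple_graph V E" and ev: "even (card V)" and v: "v \<in> V"
  shows "matching_precluding V E {e \<in> E. v \<in> e}"
proof -
  have "finite V" "\<forall>e\<in>E - {e \<in> E. v \<in> e}. e \<subseteq> V \<and> card e = 2"
    using G by (auto simp: simple_graph_def)
  then have "\<not> almost_perfect_matching V (E - {e \<in> E. v \<in> e}) M" for M
    using no_almost_perfect_matching_even ev by blast
  moreover have "\<not> perfect_matching V (E - {e \<in> E. v \<in> e}) M" for M
    using v by (auto simp: perfect_matching_def)
  ultimately show ?thesis by (auto simp: matching_precluding_def)
qed

lemma finite_matching_precluding:
  assumes "simple_graph V E"
  shows "finite {F. matching_precluding V E F}"
proof -
  have "finite E"
    using assms finite_edges by (auto simp: simple_graph_def)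
  then show ?thesis
    by (intro finite_subset[of "{F. matching_precluding V E F}" "Pow E"])
      (auto simp: matching_precluding_def)
qed

lemma min_degree_attained:
  assumes "simple_graph V E"
  obtains v where "v \<in> V" "degree E v = min_degree V E"
proof -
  have "min_degree V E \<in> degree E ` V"
    unfolding min_degree_def using assms by (intro Min_in) (auto simp: simple_graph_def)
  then show ?thesis using that by auto
qed

lemma mp_le_min_degree:
  assumes "simple_graph V E" and "even (card V)"
  shows "mp V E \<le> min_degree V E"
proof -
  obtain v where v: "v \<in> V" "degree E v = min_degree V E"
    using min_degree_attained[OF assms(1)] .
  have "mp V E \<le> card {e \<in> E. v \<in> e}"
    unfolding mp_def
    using matching_precluding_star[OF assms v(1)] finite_matching_precluding[OF assms(1)]
    by (intro Min_le) auto
  then show ?thesis using v(2) by (simp add: degree_def)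
qed

lemma mp_eq_min_degree:
  assumes G: "simple_graph V E" and ev: "even (card V)"
    and deg: "3 * card V \<le> 4 * min_degree V E"
  shows "mp V E = min_degree V E"
proof (rule antisym)
  show "mp V E \<le> min_degree V E" using mp_le_min_degree[OF G ev] .
  \<comment> \<open>The star at \<open>v\<close> makes the set of precluding sets nonempty, without
    which its \<open>Min\<close> could not be bounded below.\<close>
  obtain v where "v \<in> V" using min_degree_attained[OF G] .
  then show "min_degree V E \<le> mp V E"
    unfolding mp_def
    using matching_precluding_star[OF G ev] finite_matching_precluding[OF G]
      card_matching_precluding_ge[OF G ev deg]
    by (subst Min_ge_iff) auto
qed

theorem theorem3p6:
  fixes V :: "'a set" and E :: "'a set set" and n k :: int
  assumes "n \<ge> 4 * k + 6"
    and "simple_graph V E"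
    and "int (card V) = n"
    and "even n"
  shows "int (mp V E) = n - k \<longleftrightarrow> int (min_degree V E) = n - k"
proof -
  have ev: "even (card V)" using assms(3,4) by auto
  have le: "mp V E \<le> min_degree V E" using mp_le_min_degree[OF assms(2) ev] .
  \<comment> \<open>Since \<open>n \<ge> 4 * k + 6\<close>, a minimum degree of at least n - k
    satisfies 4 \<delta> \<ge> 4 n - 4 k \<ge> 3 n. Either side of the equivalence supplies the
    lower bound on \<delta>: directly, or from the value of \<open>mp V E\<close> through
    \<open>le\<close>.\<close>
  have "mp V E = min_degree V E" if "n - k \<le> int (min_degree V E)"
    using mp_eq_min_degree[OF assms(2) ev] that assms(1,3) by linarith
  then show ?thesis using le by auto
qed

end
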